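(* Suppose $m(x,y)=\sum_{i=1}^K m_i(x,y)$ is a finite sum of localized multipliers $m_i$ as in the context, each satisfying $\epsilon_i<\frac12$ or [$\epsilon_i\ge\frac12$ and $\delta_{i,w}<\frac12$ for some direction $w$], and each localized enough that the directional and overall estimates with the rates listed in the context hold for its kernel $K_i$. Suppose there is a $c>0$ such that for every $i$ the function $\alpha_i$ satisfies $\alpha_i>c$ on the support of $m_i$ (that is, $\alpha_i(x,y)>c$ whenever $(x_i+x,y_i+y)\in\operatorname{supp}m_i$). Let $K(t,u)=\int_{\mathbb{R}^2}m(x,y)e^{itx+iuy}\,dx\,dy=\sum_iK_i(t,u)$. (Directional version.) Let $l$ be a line through the origin with unit direction vector $v$, let $H>0$, and let $l_H$ be the set of points within distance $H$ of $l$. Let $(\sigma,\tau)$ be the slowest of the directional rates of $m_1,\dots,m_K$ in direction $v$, so that adding the estimates for the $K_i$ gives $|K(t,u)|\le C(2+|(t,u)|)^{-\sigma}(\ln(2+|(t,u)|))^{\tau}$ on $l_H$. If $(\sigma,\tau)$ is the directional rate in direction $v$ of some $m_{i_0}$ for which this rate is of sharp type, then this estimate is sharp for $m$: it does not hold on $l_H$, with any constant, when $\sigma$ is replaced by a strictly larger exponent. (Overall version.) Let $(\sigma,\tau)$ be the slowest of the overall rates of $m_1,\dots,m_K$, so that adding the estimates gives $|K(t,u)|\le C(2+|(t,u)|)^{-\sigma}(\ln(2+|(t,u)|))^{\tau}$ for all $(t,u)\in\mathbb{R}^2$. Then this estimate is sharp for $m$: it does not hold for all $(t,u)$, with any constant,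 when $\sigma$ is replaced by a strictly larger exponent.
   Context: **Local data.** Let $f_1,\dots,f_n$ be real analytic functions on a neighborhood of $(0,0)$ in $\mathbb{R}^2$, none identically zero near the origin, and let $\gamma_1,\dots,\gamma_n$ be real exponents. The set $E$ is either a disk $\{x^2+y^2<\rho^2\}$, or a disjoint union of finitely many open sets $E_1,\dots,E_q$ ($q\ge1$), where each $E_j$ is a region bounded by two curves $C_1,C_2$ connecting the origin to the circle $x^2+y^2=\rho^2$ and by that circle (either of the two regions so formed is allowed). Each such curve is half of a graph $y=h(|x|^{1/N})$ or $x=h(|y|^{1/N})$ with $N$ a positive integer, $h$ real analytic, $h(0)=0$. All the curves (over all $j$) are disjoint in $\{x^2+y^2\le\rho^2\}$ apart from the origin, so the closures of the $E_j$ meet only at the origin. Put $g(x,y)=\chi_E(x,y)\prod_{k=1}^n|f_k(x,y)|^{\gamma_k}$; it is assumed that $g$ is integrable on a neighborhood of the origin. **Exponents of local data.** $\epsilon>0$ and $d\in\{0,1\}$ are the numbers such that, for some $c_1,c_2,c_3>0$, for all $0<r<c_3$: $c_1r^\epsilon|\ln r|^d\le\int_{x^2+y^2<r^2}g\,dx\,dy\le c_2r^\epsilon|\ln r|^d$ (these exist). For a unit vector $v=(v_1,v_2)$ and $v^\perp=(v_2,-v_1)$, $\delta_v>0$ and $e_v\in\{0,1\}$ are the numbers such that, for some $c_v>0$, for each $0<c<c_v$ there are $a_{v,c},b_{v,c}>0$ with, for all $0<r<c$: $a_{v,c}r^{\delta_v}|\ln r|^{e_v}\le\int_{\{|(x,y)\cdot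 v|<r,\ |(x,y)\cdot v^\perp|<c\}}g\,dx\,dy\le b_{v,c}r^{\delta_v}|\ln r|^{e_v}$ (these exist). **Lines of local data.** Let $F_k$ be the sum of the terms of lowest total degree in the Taylor expansion of $f_k$ at $(0,0)$. The lines of the data are all lines through the origin contained in the zero set of some $F_k$, together with all lines tangent at the origin to one of the boundary curves $C_1,C_2$ of the $E_j$. **Localized multipliers.** Each $m_i$ comes with a point $(x_i,y_i)$, local data (with function $g_i$), a function $\alpha_i$ on a neighborhood of the origin which is $C^1$ except at $(0,0)$ and satisfies $|\alpha_i|\le A$, $|\nabla\alpha_i(x,y)|\le A(x^2+y^2)^{-1/2}$ for some constant $A$, and a nonnegative smooth bump function $\phi_i$ equal to $1$ near $(x_i,y_i)$ with sufficiently small support, such that $m_i(x_i+x,y_i+y)=\phi_i(x_i+x,y_i+y)\,\alpha_i(x,y)\,g_i(x,y)$. Its kernel is $K_i(t,u)=\int_{\mathbb{R}^2}m_i(x,y)e^{itx+iuy}dx\,dy$. Write $\epsilon_i,d_i,\delta_{i,v},e_{i,v}$ for the exponents of its local data. **Rates.** A pair $(\sigma,\tau)$ stands for the estimate $|K_i(t,u)|\le C(2+|(t,u)|)^{-\sigma}(\ln(2+|(t,u)|))^\tau$; $(\sigma,\tau)$ is slower than $(\sigma',\tau')$ if $\sigma<\sigma'$, or $\sigma=\sigma'$ and $\tau>\tau'$. The directional rate of $m_i$ in direction $v$ (an estimate valid on every strip $l_H$, $l$ the line through $0$ in direction $v$) is: - if $\epsilon_i<\frac12$: $(\delta_{i,v},e_{i,v})$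 when $v$ is perpendicular to one of the lines of the data, and $(\epsilon_i,d_i)$ otherwise (then $\delta_{i,v}=\epsilon_i$); in both cases the rate is of sharp type; - if $\epsilon_i\ge\frac12$ and $\delta_{i,w}<\frac12$ for some $w$: $(\delta_{i,v},e_{i,v})$ when $\delta_{i,v}<\frac12$, which is of sharp type; and $(\frac12,2)$ when $\delta_{i,v}\ge\frac12$, which is not of sharp type. The overall rate of $m_i$ (an estimate valid for all $(t,u)\in\mathbb{R}^2$) is the slowest of its directional rates over all directions; it is always of sharp type. "Sharp type" means the exponent $\sigma$ cannot be increased in the estimate for $K_i$ on the relevant set.
   Formalization: The condition α_i > c is required on the support of φ_i g_i (shifted to the point (x_i,y_i)) rather than on supp m_i; with supp m_i the claim fails, e.g. α_i = 0 gives m_i = 0 and K = 0, satisfying the condition vacuously, while no estimate is sharp. *)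

theory Defs
  imports "HOL-Analysis.Analysis"
begin

section \<open>Real analytic functions and smooth functions\<close>

type_synonym plane = "real \<times> real"

definition real_analytic_on :: "(real \<Rightarrow> real) \<Rightarrow> real set \<Rightarrow> bool" where
  "real_analytic_on h U \<longleftrightarrow>
     (\<forall>s0\<in>U. \<exists>a r. r > 0 \<and> (\<forall>s. \<bar>s\<bar> < r \<longrightarrow> (\<lambda>n. a n * s ^ n) sums h (s0 + s)))"

definition has_power_series :: "(plane \<Rightarrow> real) \<Rightarrow> plane \<Rightarrow> (nat \<Rightarrow> nat \<Rightarrow> real) \<Rightarrow> bool" where
  "has_power_series f p a \<longleftrightarrow>
     (\<exists>r>0. \<forall>x y. \<bar>x\<bar> < r \<longrightarrow> \<bar>y\<bar> < r \<longrightarrow>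
        ((\<lambda>(j, k). a j k * x ^ j * y ^ k) has_sum f (p + (x, y))) UNIV)"

definition plane_analytic_on :: "(plane \<Rightarrow> real) \<Rightarrow> plane set \<Rightarrow> bool" where
  "plane_analytic_on f U \<longleftrightarrow> (\<forall>p\<in>U. \<exists>a. has_power_series f p a)"

definition taylor :: "(plane \<Rightarrow> real) \<Rightarrow> nat \<Rightarrow> nat \<Rightarrow> real" where
  "taylor f = (THE a. has_power_series f 0 a)"

definition lowest_form :: "(plane \<Rightarrow> real) \<Rightarrow> plane \<Rightarrow> real" where
  "lowest_form f p =
     (let n = (LEAST n. \<exists>j\<le>n. taylor f j (n - j) \<noteq> 0)
      in \<Sum>j\<le>n. taylor f j (n - j) * fst p ^ j * snd p ^ (n - j))"

primrec C_k :: "nat \<Rightarrow> (plane \<Rightarrow> real) \<Rightarrow> bool" where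
  "C_k 0 \<phi> = continuous_on UNIV \<phi>"
| "C_k (Suc k) \<phi> =
     (\<exists>G. (\<forall>p. GDERIV \<phi> p :> G p) \<and> C_k k (\<lambda>p. fst (G p)) \<and> C_k k (\<lambda>p. snd (G p)))"

definition smooth :: "(plane \<Rightarrow> real) \<Rightarrow> bool" where
  "smooth \<phi> \<longleftrightarrow> (\<forall>k. C_k k \<phi>)"

section \<open>The region\<close>

text \<open>Half of the graph y = h(|x|^(1/N)), namely the half on which x has the sign s, taken from the
  origin up to the point where it reaches the circle of radius \<rho>.\<close>

definition half_graph :: "real \<Rightarrow> plane set \<Rightarrow> bool" where
  "half_graph \<rho> C \<longleftrightarrow>
     (\<exists>N h U b s. N \<ge> 1 \<and> s \<in> {-1, 1::real} \<and> b > 0 \<and> h 0 = 0 \<and>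
        open U \<and> {0..root N b} \<subseteq> U \<and> real_analytic_on h U \<and>
        (\<forall>x\<in>{0..<b}. norm (x, h (root N x)) < \<rho>) \<and> norm (b, h (root N b)) = \<rho> \<and>
        C = (\<lambda>x. (s * x, h (root N x))) ` {0..b})"

definition boundary_curve :: "real \<Rightarrow> plane set \<Rightarrow> bool" where
  "boundary_curve \<rho> C \<longleftrightarrow> half_graph \<rho> C \<or> half_graph \<rho> (prod.swap ` C)"

text \<open>\<open>region \<rho> E \<C>\<close>: the set E is admissible, with set of boundary curves \<open>\<C>\<close> (empty for the disk).
  Two curves meeting only at the origin cut the open disk into two connected components, which
  are the two regions bounded by these curves and the circle. The curves of \<open>E\<^sub>j\<close> are
  \<open>C j 1\<close> and \<open>C j 2\<close>.\<close>

definition region :: "real \<Rightarrow> plane set \<Rightarrow> plane set set \<Rightarrow> bool" where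
  "region \<rho> E \<C> \<longleftrightarrow>
     (E = ball 0 \<rho> \<and> \<C> = {}) \<or>
     (\<exists>(q::nat) (A :: nat \<Rightarrow> plane set) (C :: nat \<Rightarrow> nat \<Rightarrow> plane set).
        q \<ge> 1 \<and>
        (\<forall>j\<in>{1..q}. boundary_curve \<rho> (C j 1) \<and> boundary_curve \<rho> (C j 2) \<and>
            A j \<in> components (ball 0 \<rho> - (C j 1 \<union> C j 2))) \<and>
        disjoint_family_on A {1..q} \<and>
        (\<forall>i\<in>{1..q}. \<forall>j\<in>{1..q}. \<forall>k\<in>{1,2}. \<forall>l\<in>{1,2}.
            (i, k) \<noteq> (j, l) \<longrightarrow> C i k \<inter> C j l = {0}) \<and>
        E = (\<Union>j\<in>{1..q}. A j) \<and>
        \<C> = (\<Union>j\<in>{1..q}. {C j 1, C j 2}))"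

definition tangent_line :: "plane set \<Rightarrow> plane set \<Rightarrow> bool" where
  "tangent_line L C \<longleftrightarrow> (\<exists>w. norm w = 1 \<and> L = span {w} \<and> (sgn \<longlongrightarrow> w) (at 0 within C))"

section \<open>Local data and their exponents\<close>

record local_data =
  num :: nat
  func :: "nat \<Rightarrow> plane \<Rightarrow> real"
  expo :: "nat \<Rightarrow> real"
  radius :: real
  dom_set :: "plane set"
  curves :: "plane set set"
  eps :: real
  eps_log :: nat
  delta :: "plane \<Rightarrow> real"
  delta_log :: "plane \<Rightarrow> nat"

definition weight :: "'z local_data_scheme \<Rightarrow> plane \<Rightarrow> real" where
  "weight D p = indicator (dom_set D) p * (\<Prod>k\<in>{1..num D}. \<bar>func D k p\<bar> powr expo D k)"

definition ball_exponents :: "(plane \<Rightarrow> real) \<Rightarrow> real \<Rightarrow> nat \<Rightarrow> bool" where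
  "ball_exponents g \<epsilon> d \<longleftrightarrow> \<epsilon> > 0 \<and> d \<in> {0, 1} \<and>
     (\<exists>c1>0. \<exists>c2>0. \<exists>c3>0. \<forall>r. 0 < r \<and> r < c3 \<longrightarrow>
        c1 * r powr \<epsilon> * \<bar>ln r\<bar> ^ d \<le> (LINT p:ball 0 r|lborel. g p) \<and>
        (LINT p:ball 0 r|lborel. g p) \<le> c2 * r powr \<epsilon> * \<bar>ln r\<bar> ^ d)"

definition perp :: "plane \<Rightarrow> plane" where
  "perp v = (snd v, - fst v)"

definition strip_box :: "plane \<Rightarrow> real \<Rightarrow> real \<Rightarrow> plane set" where
  "strip_box v r c = {p. \<bar>p \<bullet> v\<bar> < r \<and> \<bar>p \<bullet> perp v\<bar> < c}"

definition strip_exponents :: "(plane \<Rightarrow> real) \<Rightarrow> plane \<Rightarrow> real \<Rightarrow> nat \<Rightarrow> bool" where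
  "strip_exponents g v \<delta> e \<longleftrightarrow> \<delta> > 0 \<and> e \<in> {0, 1} \<and>
     (\<exists>cv>0. \<forall>c. 0 < c \<and> c < cv \<longrightarrow>
        (\<exists>a>0. \<exists>b>0. \<forall>r. 0 < r \<and> r < c \<longrightarrow>
           a * r powr \<delta> * \<bar>ln r\<bar> ^ e \<le> (LINT p:strip_box v r c|lborel. g p) \<and>
           (LINT p:strip_box v r c|lborel. g p) \<le> b * r powr \<delta> * \<bar>ln r\<bar> ^ e))"

definition local_data :: "'z local_data_scheme \<Rightarrow> bool" where
  "local_data D \<longleftrightarrow>
     num D \<ge> 1 \<and>
     (\<forall>k\<in>{1..num D}. (\<exists>U. open U \<and> 0 \<in> U \<and> plane_analytic_on (func D k) U) \<and>
        \<not> (\<forall>\<^sub>F p in nhds 0. func D k p = 0)) \<and>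
     radius D > 0 \<and> region (radius D) (dom_set D) (curves D) \<and>
     (\<exists>r>0. set_integrable lborel (ball 0 r) (weight D)) \<and>
     ball_exponents (weight D) (eps D) (eps_log D) \<and>
     (\<forall>v. norm v = 1 \<longrightarrow> strip_exponents (weight D) v (delta D v) (delta_log D v))"

definition lines :: "'z local_data_scheme \<Rightarrow> plane set set" where
  "lines D =
     {L. (\<exists>w. w \<noteq> 0 \<and> L = span {w}) \<and>
         (\<exists>k\<in>{1..num D}. \<forall>p\<in>L. lowest_form (func D k) p = 0)} \<union>
     {L. \<exists>C\<in>curves D. tangent_line L C}"

section \<open>Localized multipliers\<close>

record multiplier = local_data +
  base :: plane
  amp :: "plane \<Rightarrow> real"
  bump :: "plane \<Rightarrow> real"

definition mult :: "multiplier \<Rightarrow> plane \<Rightarrow> real" where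
  "mult M p = bump M p * amp M (p - base M) * weight M (p - base M)"

text \<open>The ball of radius r is a common neighbourhood on which the local objects live. Any further
  smallness of the support of the bump function enters only through the validity of the decay
  estimates, see \<open>estimates_hold\<close> below.\<close>

definition localized_multiplier :: "multiplier \<Rightarrow> bool" where
  "localized_multiplier M \<longleftrightarrow>
     local_data M \<and>
     smooth (bump M) \<and> (\<forall>p. bump M p \<ge> 0) \<and> (\<forall>\<^sub>F p in nhds (base M). bump M p = 1) \<and>
     (\<exists>r>0.
        closure {p. bump M p \<noteq> 0} \<subseteq> ball (base M) r \<and>
        (\<forall>k\<in>{1..num M}. plane_analytic_on (func M k) (ball 0 r)) \<and>
        set_integrable lborel (ball 0 r) (weight M) \<and>
        (\<exists>A G. continuous_on (ball 0 r - {0}) G \<and>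
           (\<forall>p\<in>ball 0 r - {0}. GDERIV (amp M) p :> G p \<and>
              \<bar>amp M p\<bar> \<le> A \<and> norm (G p) \<le> A / norm p)))"

text \<open>The support of the multiplier in the condition \<open>amp > c\<close> is taken to be that of the product of its
  other two factors. With the closure of the set where \<open>mult M\<close> itself does not vanish, the
  condition would be vacuous for \<open>amp = 0\<close>, and would say nothing about a component of the
  region on which \<open>amp\<close> vanishes.\<close>

definition mult_support :: "multiplier \<Rightarrow> plane set" where
  "mult_support M = closure {p. bump M p * weight M (p - base M) \<noteq> 0}"

definition kernel :: "(plane \<Rightarrow> real) \<Rightarrow> plane \<Rightarrow> complex" where
  "kernel m t = (LINT p|lborel. complex_of_real (m p) * exp (\<i> * complex_of_real (p \<bullet> t)))"

section \<open>Rates\<close>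

type_synonym rate = "real \<times> nat"

definition slower :: "rate \<Rightarrow> rate \<Rightarrow> bool" where
  "slower s t \<longleftrightarrow> fst s < fst t \<or> (fst s = fst t \<and> snd s > snd t)"

definition slowest :: "rate set \<Rightarrow> rate \<Rightarrow> bool" where
  "slowest R s \<longleftrightarrow> s \<in> R \<and> (\<forall>t\<in>R. t \<noteq> s \<longrightarrow> slower s t)"

definition decay_estimate :: "(plane \<Rightarrow> complex) \<Rightarrow> plane set \<Rightarrow> rate \<Rightarrow> bool" where
  "decay_estimate K S s \<longleftrightarrow>
     (\<exists>C. \<forall>t\<in>S. norm (K t) \<le> C * (2 + norm t) powr (- fst s) * ln (2 + norm t) ^ snd s)"

definition sharp_estimate :: "(plane \<Rightarrow> complex) \<Rightarrow> plane set \<Rightarrow> rate \<Rightarrow> bool" where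
  "sharp_estimate K S s \<longleftrightarrow> (\<forall>\<sigma>'. \<sigma>' > fst s \<longrightarrow> \<not> decay_estimate K S (\<sigma>', snd s))"

definition strip :: "plane \<Rightarrow> real \<Rightarrow> plane set" where
  "strip v H = {t. infdist t (span {v}) \<le> H}"

text \<open>Intended only for multipliers with \<open>eps M < 1/2\<close> or \<open>delta M w < 1/2\<close> for some direction w.\<close>

definition directional_rate :: "multiplier \<Rightarrow> plane \<Rightarrow> rate" where
  "directional_rate M v =
     (if eps M < 1/2 then
        (if \<exists>L\<in>lines M. \<forall>p\<in>L. p \<bullet> v = 0 then (delta M v, delta_log M v) else (eps M, eps_log M))
      else if delta M v < 1/2 then (delta M v, delta_log M v) else (1/2, 2))"

text \<open>Being of sharp type is a label attached to the case that determines the directional rate; it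
  is not by itself the assertion that the estimate for the kernel of M is sharp.\<close>

definition sharp_type :: "multiplier \<Rightarrow> plane \<Rightarrow> bool" where
  "sharp_type M v \<longleftrightarrow> eps M < 1/2 \<or> delta M v < 1/2"

definition overall_rate :: "multiplier \<Rightarrow> rate \<Rightarrow> bool" where
  "overall_rate M s \<longleftrightarrow> slowest {directional_rate M v | v. norm v = 1} s"

text \<open>There is at most one slowest element, so s below is the overall rate of M.\<close>

definition estimates_hold :: "multiplier \<Rightarrow> bool" where
  "estimates_hold M \<longleftrightarrow>
     (\<forall>v H. norm v = 1 \<longrightarrow> H > 0 \<longrightarrow>
        decay_estimate (kernel (mult M)) (strip v H) (directional_rate M v)) \<and>
     (\<exists>s. overall_rate M s \<and> decay_estimate (kernel (mult M)) UNIV s)"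

definition mult_sum :: "nat \<Rightarrow> (nat \<Rightarrow> multiplier) \<Rightarrow> plane \<Rightarrow> real" where
  "mult_sum n M p = (\<Sum>i\<in>{1..n}. mult (M i) p)"

end

theory Submission
  imports Defs
begin

text \<open>Write $m$ for the sum of the multipliers. Since the amplitudes are positive on the supports,
  $m \ge 0$ and $m$ dominates a multiple of the weight of each summand near its base point. Hence no
  cancellation between summands is possible, and the mass of $m$ in the strip
  $|(p - b) \cdot v| < r$ around the base point $b$ of a summand is at least $a\,r^{\sigma_0}$, where
  $\sigma_0$ is an exponent of that summand with $\sigma_0 \le \sigma$ and $\sigma_0 < 1/2$.
  Conversely, decay of the kernel on the line spanned by $v$ with an exponent $\sigma' < 1$ bounds this
  mass from above: with $x = (p - b) \cdot v$,
  \[ \int m(p) \Bigl| \sum_{k<N} e^{ikx} \Bigr|^2 dp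
     = \sum_{j,k<N} e^{-i(j-k) b \cdot v} K((j-k)v) = O(N^{2 - \sigma'}), \]
  while the exponential sum has modulus at least $N/2$ where $|x| < 1/N$. So the mass of the strip with
  $r = 1/N$ is $O(N^{-\sigma'})$, which is impossible for $\sigma' > \sigma_0$.\<close>

section \<open>Comparison of rates and of decay estimates\<close>

lemma ln_power_le_powr:
  fixes a :: real
  assumes "a > 0"
  shows "\<exists>C>0. \<forall>x\<ge>1. ln x ^ k \<le> C * x powr a"
proof -
  \<comment> \<open>The k-th power of \<open>ln x \<le> x powr b / b\<close> has exponent
    \<open>b * k\<close>, which has to stay below \<open>a\<close>; the added 1 keeps
    \<open>b\<close> well defined for \<open>k = 0\<close>.\<close>
  define b where "b = a / (real k + 1)"
  have b: "b > 0" "b * real k \<le> a"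
    using assms by (simp_all add: b_def field_simps)
  have "ln x ^ k \<le> (1 / b) ^ k * x powr a" if "x \<ge> 1" for x :: real
  proof -
    have "ln x ^ k \<le> (x powr b / b) ^ k"
      using that b by (intro power_mono ln_powr_bound) auto
    also have "\<dots> = (1 / b) ^ k * x powr (b * real k)"
      using that by (simp add: power_divide powr_powr[symmetric] powr_realpow)
    also have "\<dots> \<le> (1 / b) ^ k * x powr a"
      using that b by (intro mult_left_mono powr_mono) auto
    finally show ?thesis .
  qed
  moreover have "(1 / b) ^ k > 0" using b by simp
  ultimately show ?thesis by blast
qed

text \<open>A gap between the exponents absorbs any power of the logarithm. With equal exponents
  only the powers of the logarithm differ, in the favourable direction. The range
  \<open>x \<ge> 2\<close> is that of \<open>2 + norm p\<close>; there
  \<open>ln x \<ge> ln 2 > 0\<close>, so missing logarithmic factors can be inserted at the cost of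
  a constant.\<close>

lemma slower_bound:
  assumes "slower s t"
  shows "\<exists>C>0. \<forall>x\<ge>2. x powr (- fst t) * ln x ^ snd t \<le> C * (x powr (- fst s) * ln x ^ snd s)"
proof -
  have ln2: "0 < ln (2::real)" "\<And>x::real. x \<ge> 2 \<Longrightarrow> ln 2 \<le> ln x" by auto
  show ?thesis
  proof (cases "fst s < fst t")
    case True
    then obtain B where B: "B > 0" "\<And>x. x \<ge> 1 \<Longrightarrow> ln x ^ snd t \<le> B * x powr (fst t - fst s)"
      using ln_power_le_powr[of "fst t - fst s" "snd t"] by auto
    have "x powr (- fst t) * ln x ^ snd t \<le> (B / ln 2 ^ snd s) * (x powr (- fst s) * ln x ^ snd s)"
      if "x \<ge> 2" for x :: real
    proof -
      have "x powr (- fst t) * ln x ^ snd t \<le> x powr (- fst t) * (B * x powr (fst t - fst s))"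
        using B(2)[of x] that by (intro mult_left_mono) auto
      also have "\<dots> = B * x powr (- fst s)"
        using that by (simp add: powr_add[symmetric])
      also have "\<dots> \<le> B * x powr (- fst s) * (ln x ^ snd s / ln 2 ^ snd s)"
      proof -
        have "ln 2 ^ snd s \<le> ln x ^ snd s" using ln2 that by (intro power_mono) auto
        then have "1 \<le> ln x ^ snd s / ln 2 ^ snd s" using ln2 by (simp add: field_simps)
        moreover have "0 \<le> B * x powr (- fst s)" using B by simp
        ultimately show ?thesis by (metis mult.right_neutral mult_left_mono)
      qed
      finally show ?thesis by (simp add: mult_ac)
    qed
    moreover have "B / ln 2 ^ snd s > 0" using B ln2 by simp
    ultimately show ?thesis by blast
  next
    case False
    with assms have eq: "fst s = fst t" and gt: "snd s > snd t"
      by (auto simp: slower_def)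
    define k where "k = snd s - snd t"
    have k: "snd s = snd t + k" using gt by (simp add: k_def)
    have "x powr (- fst t) * ln x ^ snd t \<le> (1 / ln 2 ^ k) * (x powr (- fst s) * ln x ^ snd s)"
      if "x \<ge> 2" for x :: real
    proof -
      have "ln 2 ^ k \<le> ln x ^ k" using ln2 that by (intro power_mono) auto
      then have "1 \<le> ln x ^ k / ln 2 ^ k" using ln2 by (simp add: field_simps)
      moreover have "0 \<le> x powr (- fst t) * ln x ^ snd t" using that by simp
      ultimately have "x powr (- fst t) * ln x ^ snd t
          \<le> (x powr (- fst t) * ln x ^ snd t) * (ln x ^ k / ln 2 ^ k)"
        by (metis mult.right_neutral mult_left_mono)
      then show ?thesis by (simp add: eq k power_add mult_ac)
    qed
    moreover have "1 / ln (2::real) ^ k > 0" by simp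
    ultimately show ?thesis by blast
  qed
qed

lemma decay_estimate_slower:
  assumes "decay_estimate K S t" "slower s t"
  shows "decay_estimate K S s"
proof -
  obtain C where C: "\<And>p. p \<in> S \<Longrightarrow> norm (K p) \<le> C * (2 + norm p) powr (- fst t) * ln (2 + norm p) ^ snd t"
    using assms(1) by (auto simp: decay_estimate_def)
  obtain B where B: "B > 0" "\<And>x. x \<ge> 2 \<Longrightarrow> x powr (- fst t) * ln x ^ snd t \<le> B * (x powr (- fst s) * ln x ^ snd s)"
    using slower_bound[OF assms(2)] by auto
  have "norm (K p) \<le> (\<bar>C\<bar> * B) * (2 + norm p) powr (- fst s) * ln (2 + norm p) ^ snd s"
    if "p \<in> S" for p
  proof -
    let ?x = "2 + norm p"
    have "norm (K p) \<le> C * (?x powr (- fst t) * ln ?x ^ snd t)"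
      using C[OF that] by (simp add: mult_ac)
    \<comment> \<open>The constant in \<open>decay_estimate\<close> may be negative, and the next
      step multiplies an inequality by it.\<close>
    also have "\<dots> \<le> \<bar>C\<bar> * (?x powr (- fst t) * ln ?x ^ snd t)"
      by (intro mult_right_mono mult_nonneg_nonneg zero_le_power) (auto intro: ln_ge_zero)
    also have "\<dots> \<le> \<bar>C\<bar> * (B * (?x powr (- fst s) * ln ?x ^ snd s))"
      by (intro mult_left_mono B) auto
    finally show ?thesis by (simp add: mult_ac)
  qed
  then show ?thesis unfolding decay_estimate_def by blast
qed

lemma decay_estimate_subset:
  "decay_estimate K T s \<Longrightarrow> S \<subseteq> T \<Longrightarrow> decay_estimate K S s"
  unfolding decay_estimate_def by blast

lemma decay_estimate_sum:
  assumes "\<And>i. i \<in> I \<Longrightarrow> decay_estimate (K i) S s"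
  shows "decay_estimate (\<lambda>t. \<Sum>i\<in>I. K i t) S s"
proof -
  have "\<forall>i\<in>I. \<exists>C. \<forall>t\<in>S. norm (K i t) \<le> C * (2 + norm t) powr (- fst s) * ln (2 + norm t) ^ snd s"
    using assms by (auto simp: decay_estimate_def)
  then obtain C where C: "\<forall>i\<in>I. \<forall>t\<in>S. norm (K i t) \<le> C i * (2 + norm t) powr (- fst s) * ln (2 + norm t) ^ snd s"
    by metis
  have "norm (\<Sum>i\<in>I. K i t) \<le> (\<Sum>i\<in>I. C i) * (2 + norm t) powr (- fst s) * ln (2 + norm t) ^ snd s"
    if "t \<in> S" for t
    using sum_norm_le[of I "\<lambda>i. K i t"] C that by (simp add: sum_distrib_right)
  then show ?thesis unfolding decay_estimate_def by blast
qed

section \<open>Bounding the mass of a strip by the decay of the kernel\<close>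

text \<open>Comparison with the integral of \<open>x powr (- \<sigma>)\<close>: by the mean value
  theorem each term is at most the increment of the antiderivative over the matching unit interval,
  and the increments telescope.\<close>

lemma sum_powr_le:
  fixes \<sigma> :: real
  assumes "0 < \<sigma>" "\<sigma> < 1"
  shows "(\<Sum>k<N. (2 + real k) powr (- \<sigma>)) \<le> real N powr (1 - \<sigma>) / (1 - \<sigma>)"
proof (induction N)
  case 0
  then show ?case by simp
next
  case (Suc N)
  have step: "real N powr (1 - \<sigma>) / (1 - \<sigma>) + (2 + real N) powr (- \<sigma>) \<le> real (Suc N) powr (1 - \<sigma>) / (1 - \<sigma>)"
  \<comment> \<open>On the first interval the antiderivative is not differentiable at 0, so the mean
    value theorem serves only \<open>N > 0\<close>; for \<open>N = 0\<close> both sides are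
    explicit.\<close>
  proof (cases "N = 0")
    case True
    have "2 powr (- \<sigma>) \<le> 2 powr (0::real)" using assms by (intro powr_mono) auto
    also have "\<dots> \<le> 1 / (1 - \<sigma>)" using assms by simp
    finally show ?thesis using True by simp
  next
    case False
    have "((\<lambda>x. x powr (1 - \<sigma>) / (1 - \<sigma>)) has_real_derivative x powr (- \<sigma>)) (at x)"
      if "real N \<le> x" "x \<le> real N + 1" for x
      using DERIV_cdivide[OF has_real_derivative_powr[of x "1 - \<sigma>"], of "1 - \<sigma>"] that False assms by simp
    from MVT2[of "real N" "real N + 1" "\<lambda>x. x powr (1 - \<sigma>) / (1 - \<sigma>)", OF _ this]
    obtain z where z: "z > real N" "z < real N + 1"
      "(real N + 1) powr (1 - \<sigma>) / (1 - \<sigma>) - real N powr (1 - \<sigma>) / (1 - \<sigma>) = z powr (- \<sigma>)"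
      by auto
    have "(2 + real N) powr (- \<sigma>) \<le> z powr (- \<sigma>)"
      using z assms by (intro powr_mono2') auto
    with z show ?thesis by (simp add: add.commute)
  qed
  show ?case using Suc step by simp
qed

text \<open>This bounds a row sum of a matrix whose entries depend only on the distance to the
  diagonal: each distance occurs at most once on either side of \<open>j\<close>.\<close>

lemma sum_abs_diff_le:
  fixes f :: "nat \<Rightarrow> real"
  assumes nonneg: "\<And>l. f l \<ge> 0" and j: "j < N"
  shows "(\<Sum>k<N. f (nat \<bar>int j - int k\<bar>)) \<le> 2 * (\<Sum>l<N. f l)"
proof -
  have "(\<Sum>k<N. f (nat \<bar>int j - int k\<bar>))
      = (\<Sum>k\<in>{..j}. f (nat \<bar>int j - int k\<bar>)) + (\<Sum>k\<in>{Suc j..<N}. f (nat \<bar>int j - int k\<bar>))"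
    using j by (subst sum.union_disjoint[symmetric]) (auto intro!: sum.cong)
  also have "(\<Sum>k\<in>{..j}. f (nat \<bar>int j - int k\<bar>)) = (\<Sum>l\<in>{..j}. f l)"
    by (rule sum.reindex_bij_witness[of _ "\<lambda>l. j - l" "\<lambda>l. j - l"])
       (auto simp: of_nat_diff intro!: arg_cong[where f = f])
  also have "\<dots> \<le> (\<Sum>l<N. f l)"
    using j nonneg by (intro sum_mono2) auto
  also have "(\<Sum>k\<in>{Suc j..<N}. f (nat \<bar>int j - int k\<bar>)) = (\<Sum>l\<in>{1..<N-j}. f l)"
    by (rule sum.reindex_bij_witness[of _ "\<lambda>l. j + l" "\<lambda>k. k - j"])
       (auto simp: of_nat_diff intro!: arg_cong[where f = f])
  also have "\<dots> \<le> (\<Sum>l<N. f l)"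
    using nonneg by (intro sum_mono2) auto
  finally show ?thesis by simp
qed

lemma integrable_times_exp:
  fixes m :: "plane \<Rightarrow> real"
  assumes "integrable lborel m"
  shows "integrable lborel (\<lambda>p. complex_of_real (m p) * exp (\<i> * complex_of_real (p \<bullet> t)))"
proof (rule Bochner_Integration.integrable_bound[OF assms])
  have [measurable]: "m \<in> borel_measurable borel" using assms by auto
  have [measurable]: "(\<lambda>p. exp (\<i> * complex_of_real (p \<bullet> t))) \<in> borel_measurable borel"
    by (intro borel_measurable_continuous_onI continuous_intros)
  show "(\<lambda>p. complex_of_real (m p) * exp (\<i> * complex_of_real (p \<bullet> t))) \<in> borel_measurable lborel"
    by measurable
qed (auto simp: norm_mult)

lemma cos_ge_half: "\<bar>y\<bar> \<le> 1 \<Longrightarrow> cos y \<ge> 1/2" for y :: real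
proof -
  assume y: "\<bar>y\<bar> \<le> 1"
  have "\<bar>sin (y/2)\<bar> \<le> \<bar>y/2\<bar>" by (rule abs_sin_x_le_abs_x)
  also have "\<dots> \<le> 1/2" using y by simp
  finally have "(sin (y/2))\<^sup>2 \<le> (1/2)\<^sup>2" by (metis abs_ge_zero power2_abs power_mono)
  moreover have "cos y = 1 - 2 * (sin (y/2))\<^sup>2" using cos_double_sin[of "y/2"] by simp
  ultimately show ?thesis by (simp add: power2_eq_square)
qed

text \<open>Only the values of the kernel at integer multiples of \<open>v\<close> enter, so decay
  on any strip around the line of \<open>v\<close> suffices. For \<open>\<sigma> < 1\<close> the row
  sums of the resulting double sum are of order \<open>N powr (1 - \<sigma>)\<close>. The centre
  \<open>b\<close> is free because moving it changes the terms only by unimodular factors.\<close>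

lemma strip_mass_le:
  fixes m :: "plane \<Rightarrow> real"
  assumes int: "integrable lborel m" and nonneg: "\<And>p. m p \<ge> 0"
    and \<sigma>: "0 < \<sigma>" "\<sigma> < 1"
    and decay: "\<And>k::int. norm (kernel m (of_int k *\<^sub>R v)) \<le> C * (2 + \<bar>of_int k\<bar>) powr (- \<sigma>)"
    and N: "N > 0"
  shows "(LINT p:{p. \<bar>(p - b) \<bullet> v\<bar> < 1 / real N}|lborel. m p) \<le> 8 * \<bar>C\<bar> / (1 - \<sigma>) * real N powr (- \<sigma>)"
proof -
  have [measurable]: "m \<in> borel_measurable borel" using int by auto
  define x where "x p = (p - b) \<bullet> v" for p
  have [measurable]: "x \<in> borel_measurable borel"
    unfolding x_def by (intro borel_measurable_continuous_onI continuous_intros)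
  define D where "D p = (\<Sum>k<N. cis (real k * x p))" for p
  \<comment> \<open>The integral of \<open>E j k\<close> is the kernel at \<open>(j - k) v\<close>;
    the phase \<open>w j k\<close> accounts for centring the strip at \<open>b\<close> and has
    modulus 1.\<close>
  define E where "E j k p = complex_of_real (m p) * exp (\<i> * complex_of_real (p \<bullet> (of_int (int j - int k) *\<^sub>R v)))"
    for j k p
  define w where "w j k = cis (- (real j - real k) * (b \<bullet> v))" for j k :: nat
  have Eint: "integrable lborel (E j k)" for j k
    unfolding E_def using integrable_times_exp[OF int] .
  have expand: "complex_of_real (m p * (norm (D p))\<^sup>2) = (\<Sum>j<N. \<Sum>k<N. w j k * E j k p)" for p
  proof -
    have "complex_of_real (m p * (norm (D p))\<^sup>2) = of_real (m p) * (D p * cnj (D p))"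
      by (simp only: of_real_mult complex_norm_square)
    also have "D p * cnj (D p) = (\<Sum>j<N. \<Sum>k<N. cis ((real j - real k) * x p))"
      by (simp add: D_def sum_product cis_mult cis_cnj algebra_simps)
    also have "of_real (m p) * \<dots> = (\<Sum>j<N. \<Sum>k<N. w j k * E j k p)"
    proof -
      have "of_real (m p) * cis ((real j - real k) * x p) = w j k * E j k p" for j k
      proof -
        have "cis ((real j - real k) * x p) = w j k * cis (p \<bullet> (of_int (int j - int k) *\<^sub>R v))"
          by (simp add: w_def cis_mult x_def inner_diff_left algebra_simps)
        then show ?thesis by (simp add: E_def cis_conv_exp mult_ac)
      qed
      then show ?thesis by (simp add: sum_distrib_left)
    qed
    finally show ?thesis .
  qed
  have Dle: "norm (D p) \<le> real N" for p
    unfolding D_def using sum_norm_le[of "{..<N}" "\<lambda>k. cis (real k * x p)" "\<lambda>_. 1"] by simp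
  \<comment> \<open>For \<open>k < N\<close> the angle \<open>k * x\<close> is at most 1 in absolute
    value, so every term of \<open>D\<close> has real part at least 1/2.\<close>
  have Dge: "norm (D p) \<ge> real N / 2" if "\<bar>x p\<bar> < 1 / real N" for p
  proof -
    have "\<bar>real k * x p\<bar> \<le> 1" if "k < N" for k
    proof -
      have "\<bar>real k * x p\<bar> \<le> real N * (1 / real N)"
        unfolding abs_mult using that \<open>\<bar>x p\<bar> < 1 / real N\<close> by (intro mult_mono) auto
      then show ?thesis using N by simp
    qed
    then have "(\<Sum>k<N. 1/2) \<le> (\<Sum>k<N. cos (real k * x p))"
      by (intro sum_mono cos_ge_half) auto
    also have "\<dots> = Re (D p)" by (simp add: D_def)
    also have "\<dots> \<le> norm (D p)" by (rule complex_Re_le_cmod)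
    finally show ?thesis by simp
  qed
  \<comment> \<open>Integrability is read off from the finite expansion, since each
    \<open>E j k\<close> is \<open>m\<close> times a unimodular function.\<close>
  have cD: "(\<lambda>p. complex_of_real (m p * (norm (D p))\<^sup>2)) = (\<lambda>p. \<Sum>j<N. \<Sum>k<N. w j k * E j k p)"
    using expand by blast
  have cint: "integrable lborel (\<lambda>p. complex_of_real (m p * (norm (D p))\<^sup>2))"
    unfolding cD by (intro Bochner_Integration.integrable_sum integrable_mult_right Eint)
  have rint: "integrable lborel (\<lambda>p. m p * (norm (D p))\<^sup>2)"
    using integrable_Re[OF cint] by (simp del: of_real_mult of_real_power)
  let ?S = "{p. \<bar>(p - b) \<bullet> v\<bar> < 1 / real N}"
  have S: "?S \<in> sets lborel"
  proof -
    have "?S = {p\<in>space borel. \<bar>x p\<bar> < 1 / real N}" by (auto simp: x_def)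
    also have "\<dots> \<in> sets borel" by measurable
    finally show ?thesis by simp
  qed
  have "(real N)\<^sup>2 / 4 * (LINT p:?S|lborel. m p) = (LINT p|lborel. (real N)\<^sup>2 / 4 * (indicator ?S p * m p))"
    by (simp add: set_lebesgue_integral_def)
  also have "\<dots> \<le> (LINT p|lborel. m p * (norm (D p))\<^sup>2)"
  proof (rule integral_mono)
    show "integrable lborel (\<lambda>p. (real N)\<^sup>2 / 4 * (indicator ?S p * m p))"
      using integrable_mult_indicator[OF S int] by simp
    show "(real N)\<^sup>2 / 4 * (indicator ?S p * m p) \<le> m p * (norm (D p))\<^sup>2" for p
    proof (cases "p \<in> ?S")
      case True
      have "(real N / 2)\<^sup>2 \<le> (norm (D p))\<^sup>2" using Dge[of p] True by (intro power_mono) (auto simp: x_def)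
      then have "m p * (real N / 2)\<^sup>2 \<le> m p * (norm (D p))\<^sup>2"
        using nonneg by (intro mult_left_mono) auto
      then show ?thesis using True by (simp add: power_divide mult_ac)
    qed (use nonneg in auto)
  qed (rule rint)
  also have "\<dots> \<le> norm (LINT p|lborel. complex_of_real (m p * (norm (D p))\<^sup>2))"
    by (subst integral_complex_of_real) (auto simp del: of_real_mult of_real_power)
  also have "(LINT p|lborel. complex_of_real (m p * (norm (D p))\<^sup>2))
      = (\<Sum>j<N. \<Sum>k<N. w j k * kernel m (of_int (int j - int k) *\<^sub>R v))"
  proof -
    have "(LINT p|lborel. (\<Sum>j<N. \<Sum>k<N. w j k * E j k p)) = (\<Sum>j<N. \<Sum>k<N. w j k * (LINT p|lborel. E j k p))"
      using Eint by (simp add: Bochner_Integration.integral_sum)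
    then show ?thesis unfolding cD kernel_def E_def .
  qed
  also have "norm \<dots> \<le> (\<Sum>j<N. \<Sum>k<N. \<bar>C\<bar> * (2 + real (nat \<bar>int j - int k\<bar>)) powr (- \<sigma>))"
  proof (intro sum_norm_le)
    fix j k :: nat
    have "norm (w j k * kernel m (of_int (int j - int k) *\<^sub>R v)) = norm (kernel m (of_int (int j - int k) *\<^sub>R v))"
      by (simp add: norm_mult w_def)
    also have "\<dots> \<le> C * (2 + \<bar>of_int (int j - int k)\<bar>) powr (- \<sigma>)" by (rule decay)
    also have "\<dots> \<le> \<bar>C\<bar> * (2 + \<bar>of_int (int j - int k)\<bar>) powr (- \<sigma>)" by (intro mult_right_mono) auto
    finally show "norm (w j k * kernel m (of_int (int j - int k) *\<^sub>R v))
      \<le> \<bar>C\<bar> * (2 + real (nat \<bar>int j - int k\<bar>)) powr (- \<sigma>)" by simp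
  qed
  also have "\<dots> = (\<Sum>j<N. \<bar>C\<bar> * (\<Sum>k<N. (2 + real (nat \<bar>int j - int k\<bar>)) powr (- \<sigma>)))"
    by (simp add: sum_distrib_left)
  also have "\<dots> \<le> (\<Sum>j<N. \<bar>C\<bar> * (2 * (real N powr (1 - \<sigma>) / (1 - \<sigma>))))"
  proof (intro sum_mono mult_left_mono)
    fix j assume "j \<in> {..<N}"
    then have "(\<Sum>k<N. (2 + real (nat \<bar>int j - int k\<bar>)) powr (- \<sigma>)) \<le> 2 * (\<Sum>l<N. (2 + real l) powr (- \<sigma>))"
      by (intro sum_abs_diff_le) auto
    also have "\<dots> \<le> 2 * (real N powr (1 - \<sigma>) / (1 - \<sigma>))"
      by (intro mult_left_mono sum_powr_le \<sigma>) simp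
    finally show "(\<Sum>k<N. (2 + real (nat \<bar>int j - int k\<bar>)) powr (- \<sigma>)) \<le> \<dots>" .
  qed auto
  \<comment> \<open>The 8 is the 2 from the two sides of the diagonal times the 4 from the lower
    bound \<open>N / 2\<close> for \<open>norm (D p)\<close>, squared.\<close>
  also have "\<dots> = (real N)\<^sup>2 / 4 * (8 * \<bar>C\<bar> / (1 - \<sigma>) * real N powr (- \<sigma>))"
  proof -
    have "real N powr (1 - \<sigma>) = real N * real N powr (- \<sigma>)"
      using N by (simp add: powr_diff powr_minus field_simps)
    then show ?thesis by (simp add: power2_eq_square)
  qed
  finally show ?thesis by (rule mult_left_le_imp_le) (use N in simp)
qed

section \<open>Integrability and positivity of a localized multiplier\<close>

lemma integrable_shift:
  fixes f :: "plane \<Rightarrow> real"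
  assumes "integrable lborel f"
  shows "integrable lborel (\<lambda>p. f (p - b))" "(LINT p|lborel. f (p - b)) = (LINT p|lborel. f p)"
proof -
  have [measurable]: "f \<in> borel_measurable borel" using assms by auto
  have eq: "distr lborel borel ((+) (- b)) = (lborel :: plane measure)" by (rule lborel_distr_plus)
  show "integrable lborel (\<lambda>p. f (p - b))"
    using integrable_distr_eq[of "(+) (- b)" lborel borel f] assms unfolding eq by simp
  show "(LINT p|lborel. f (p - b)) = (LINT p|lborel. f p)"
    using integral_distr[of "(+) (- b)" lborel borel f] unfolding eq by simp
qed

lemma weight_nonneg: "weight D p \<ge> 0"
  unfolding weight_def by (intro mult_nonneg_nonneg prod_nonneg) auto

lemma smooth_continuous: "smooth \<phi> \<Longrightarrow> continuous_on UNIV \<phi>"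
  unfolding smooth_def by (metis C_k.simps(1))

text \<open>The bump function is bounded, being continuous with compact support, and the amplitude
  is bounded near the origin, so the multiplier is dominated by a constant times the translated
  weight, restricted to a ball where it is integrable.\<close>

lemma integrable_mult:
  assumes "localized_multiplier M"
  shows "integrable lborel (mult M)"
proof -
  obtain r A G where r: "r > 0" and supp: "closure {p. bump M p \<noteq> 0} \<subseteq> ball (base M) r"
    and wint: "set_integrable lborel (ball 0 r) (weight M)"
    and G: "\<And>p. p \<in> ball 0 r - {0} \<Longrightarrow> GDERIV (amp M) p :> G p"
    and A: "\<And>p. p \<in> ball 0 r - {0} \<Longrightarrow> \<bar>amp M p\<bar> \<le> A"
    and sm: "smooth (bump M)"
    using assms unfolding localized_multiplier_def by blast
  have bumpc: "continuous_on UNIV (bump M)" using smooth_continuous[OF sm] .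
  have bump0: "bump M p = 0" if "p \<notin> ball (base M) r" for p
    using that supp closure_subset[of "{p. bump M p \<noteq> 0}"] by blast
  obtain B where B: "\<And>p. \<bar>bump M p\<bar> \<le> B"
  proof -
    have "bounded (closure {p. bump M p \<noteq> 0})" using supp bounded_subset bounded_ball by blast
    then have "compact (closure {p. bump M p \<noteq> 0})" by (simp add: compact_eq_bounded_closed)
    then have "compact (bump M ` closure {p. bump M p \<noteq> 0})"
      using bumpc by (meson compact_continuous_image continuous_on_subset subset_UNIV)
    then obtain B where B: "\<forall>y\<in>bump M ` closure {p. bump M p \<noteq> 0}. norm y \<le> B"
      using compact_imp_bounded bounded_iff by metis
    have "\<bar>bump M p\<bar> \<le> max B 0" for p
    proof (cases "bump M p = 0")
      case False
      then have "p \<in> closure {p. bump M p \<noteq> 0}" by (intro closure_subset[THEN subsetD]) simp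
      then have "norm (bump M p) \<le> B" using B by blast
      then show ?thesis by simp
    qed auto
    then show thesis using that by blast
  qed
  \<comment> \<open>The amplitude is controlled only on the punctured ball. Hence it is cut off
    outside the ball, and its value at 0 is added as a separate term. The weight is cut off likewise
    in \<open>g\<close>; this leaves the product unchanged because the bump function vanishes
    outside the ball.\<close>
  define \<alpha> where "\<alpha> p = indicator (ball 0 r - {0}) p *\<^sub>R amp M p + indicator {0} p * amp M 0" for p
  define g where "g p = indicator (ball 0 r) p *\<^sub>R weight M p" for p
  have gint: "integrable lborel g" using wint by (simp add: g_def[abs_def] set_integrable_def)
  have "continuous_on (ball 0 r - {0}) (amp M)"
    using G unfolding gderiv_def by (meson continuous_at_imp_continuous_on has_derivative_continuous)
  then have [measurable]: "(\<lambda>p. indicator (ball 0 r - {0}) p *\<^sub>R amp M p) \<in> borel_measurable borel"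
    by (intro borel_measurable_continuous_on_indicator) auto
  have [measurable]: "\<alpha> \<in> borel_measurable borel" unfolding \<alpha>_def by measurable
  have [measurable]: "bump M \<in> borel_measurable borel" using bumpc by (rule borel_measurable_continuous_onI)
  have [measurable]: "g \<in> borel_measurable borel" using gint by auto
  define A' where "A' = max \<bar>A\<bar> \<bar>amp M 0\<bar>"
  have \<alpha>: "\<bar>\<alpha> p\<bar> \<le> A'" for p
    using A[of p] by (cases "p = 0"; cases "p \<in> ball 0 r") (auto simp: \<alpha>_def A'_def)
  have eq: "mult M p = bump M p * \<alpha> (p - base M) * g (p - base M)" for p
  proof (cases "p \<in> ball (base M) r")
    case True
    then have "p - base M \<in> ball 0 r" by (simp add: dist_norm norm_minus_commute)
    then show ?thesis by (cases "p = base M") (auto simp: mult_def \<alpha>_def g_def indicator_def)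
  qed (simp add: mult_def bump0)
  show ?thesis
  proof (rule Bochner_Integration.integrable_bound)
    show "integrable lborel (\<lambda>p. B * A' * g (p - base M))"
      using integrable_shift(1)[OF gint] by simp
    show "mult M \<in> borel_measurable lborel" unfolding eq[abs_def] by measurable
    have "norm (mult M p) \<le> norm (B * A' * g (p - base M))" for p
    proof -
      have "B \<ge> 0" "A' \<ge> 0" using B[of p] \<alpha>[of p] by linarith+
      have "\<bar>bump M p\<bar> * \<bar>\<alpha> (p - base M)\<bar> \<le> B * A'"
        using \<open>B \<ge> 0\<close> by (intro mult_mono B \<alpha>) auto
      then show ?thesis
        using \<open>B \<ge> 0\<close> \<open>A' \<ge> 0\<close> unfolding eq by (auto simp: abs_mult intro!: mult_right_mono)
    qed
    then show "AE p in lborel. norm (mult M p) \<le> norm (B * A' * g (p - base M))" by simp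
  qed
qed

lemma bump_nonneg: "localized_multiplier M \<Longrightarrow> bump M p \<ge> 0"
  unfolding localized_multiplier_def by blast

text \<open>At each point either bump times weight vanishes, and then so do both sides, or the point
  lies in the support and the amplitude exceeds \<open>c\<close>. This removes the amplitude from
  the lower bounds that follow.\<close>

lemma mult_ge:
  assumes "localized_multiplier M" and "\<forall>p. base M + p \<in> mult_support M \<longrightarrow> amp M p > c"
  shows "mult M p \<ge> c * (bump M p * weight M (p - base M))"
proof (cases "bump M p * weight M (p - base M) = 0")
  case False
  then have "p \<in> mult_support M"
    unfolding mult_support_def by (intro closure_subset[THEN subsetD]) simp
  then have "amp M (p - base M) > c" using assms(2)[rule_format, of "p - base M"] by simp
  moreover have "bump M p * weight M (p - base M) \<ge> 0"
    using bump_nonneg[OF assms(1)] weight_nonneg by (rule mult_nonneg_nonneg)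
  ultimately have "c * (bump M p * weight M (p - base M))
      \<le> amp M (p - base M) * (bump M p * weight M (p - base M))"
    by (intro mult_right_mono) auto
  then show ?thesis by (simp add: mult_def mult_ac)
next
  case True
  then have "mult M p = 0" unfolding mult_def by (metis mult_eq_0_iff)
  then show ?thesis unfolding True by simp
qed

lemma mult_nonneg:
  assumes "localized_multiplier M" "\<forall>p. base M + p \<in> mult_support M \<longrightarrow> amp M p > c" "c > 0"
  shows "mult M p \<ge> 0"
proof -
  have "0 \<le> c * (bump M p * weight M (p - base M))"
    using assms(3) by (intro mult_nonneg_nonneg bump_nonneg[OF assms(1)] weight_nonneg) simp
  also have "\<dots> \<le> mult M p" by (rule mult_ge[OF assms(1,2)])
  finally show ?thesis .
qed

section \<open>Lower bounds for the mass of strips\<close>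

text \<open>Parseval's identity for the orthonormal basis formed by \<open>v\<close> and
  \<open>perp v\<close>.\<close>

lemma inner_perp_decomp:
  assumes "norm v = 1"
  shows "(norm p)\<^sup>2 = (p \<bullet> v)\<^sup>2 + (p \<bullet> perp v)\<^sup>2"
proof -
  obtain a b where v: "v = (a, b)" by fastforce
  obtain x y where p: "p = (x, y)" by fastforce
  have "a\<^sup>2 + b\<^sup>2 = 1" using assms by (simp add: v norm_Pair real_sqrt_eq_1_iff)
  have "(norm p)\<^sup>2 = (x\<^sup>2 + y\<^sup>2) * (a\<^sup>2 + b\<^sup>2)"
    by (simp add: p norm_Pair \<open>a\<^sup>2 + b\<^sup>2 = 1\<close>)
  also have "\<dots> = (x * a + y * b)\<^sup>2 + (x * b - y * a)\<^sup>2"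
    by algebra
  finally show ?thesis by (simp add: v p perp_def)
qed

lemma strip_box_subset_ball:
  assumes "norm v = 1" "r \<le> c"
  shows "strip_box v r c \<subseteq> ball 0 (2 * c)"
proof
  fix p assume p: "p \<in> strip_box v r c"
  have 1: "\<bar>p \<bullet> v\<bar> < c" "\<bar>p \<bullet> perp v\<bar> < c" using p assms by (auto simp: strip_box_def)
  then have c: "c > 0" by linarith
  have "(p \<bullet> v)\<^sup>2 < c\<^sup>2" "(p \<bullet> perp v)\<^sup>2 < c\<^sup>2"
    using 1 c power_strict_mono[of "\<bar>p \<bullet> v\<bar>" c 2] power_strict_mono[of "\<bar>p \<bullet> perp v\<bar>" c 2] by simp_all
  then have "(norm p)\<^sup>2 < 2 * c\<^sup>2" using inner_perp_decomp[OF assms(1), of p] by linarith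
  also have "\<dots> \<le> (2 * c)\<^sup>2" by (simp add: power2_eq_square)
  finally show "p \<in> ball 0 (2 * c)" using c power2_less_imp_less[of "norm p" "2 * c"] by simp
qed

lemma ball_subset_strip_box:
  assumes "norm v = 1" "r \<le> c"
  shows "ball 0 r \<subseteq> strip_box v r c"
proof
  fix p :: plane assume p: "p \<in> ball 0 r"
  have "(p \<bullet> v)\<^sup>2 \<le> (norm p)\<^sup>2" "(p \<bullet> perp v)\<^sup>2 \<le> (norm p)\<^sup>2"
    using inner_perp_decomp[OF assms(1), of p] by auto
  then have "\<bar>p \<bullet> v\<bar> \<le> norm p" "\<bar>p \<bullet> perp v\<bar> \<le> norm p"
    by (metis norm_ge_zero power2_abs power2_le_imp_le)+
  then show "p \<in> strip_box v r c" using p assms(2) by (auto simp: strip_box_def)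
qed

lemma strip_box_measurable: "strip_box v r c \<in> sets lborel"
proof -
  have "open (strip_box v r c)" unfolding strip_box_def
    by (intro open_Collect_conj open_Collect_less continuous_intros)
  then show ?thesis by simp
qed

text \<open>This lets the logarithmic factors in the definitions of the exponents be dropped from
  lower bounds at small radii.\<close>

lemma abs_ln_power_ge_1:
  fixes r :: real
  assumes "0 < r" "r \<le> exp (- 1)"
  shows "\<bar>ln r\<bar> ^ d \<ge> 1"
proof -
  have "ln r \<le> ln (exp (- 1))" using assms by (subst ln_le_cancel_iff) auto
  then show ?thesis by (intro one_le_power) auto
qed

text \<open>The lower half of the defining estimate for \<open>delta D v\<close>. Since that
  estimate is available for every small \<open>c\<close>, the box can be made smaller than any
  \<open>\<eta>\<close>; this is later used to place it where the bump function equals 1.\<close>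

lemma strip_mass_ge_delta:
  assumes "local_data D" "norm v = 1" "\<eta> > 0"
  shows "\<exists>a>0. \<exists>c>0. c < \<eta> \<and> (\<exists>r0>0. \<forall>r. 0 < r \<and> r < r0 \<longrightarrow>
           r < c \<and> a * r powr delta D v \<le> (LINT p:strip_box v r c|lborel. weight D p))"
proof -
  have "strip_exponents (weight D) v (delta D v) (delta_log D v)"
    using assms unfolding local_data_def by blast
  then obtain cv where cv: "cv > 0" and ex: "\<And>c. 0 < c \<Longrightarrow> c < cv \<Longrightarrow> \<exists>a>0. \<forall>r. 0 < r \<and> r < c \<longrightarrow>
        a * r powr delta D v * \<bar>ln r\<bar> ^ delta_log D v \<le> (LINT p:strip_box v r c|lborel. weight D p)"
    unfolding strip_exponents_def by metis
  define c where "c = min \<eta> cv / 2"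
  have c: "0 < c" "c < cv" "c < \<eta>" using cv assms by (auto simp: c_def)
  obtain a where a: "a > 0" "\<And>r. 0 < r \<Longrightarrow> r < c \<Longrightarrow>
      a * r powr delta D v * \<bar>ln r\<bar> ^ delta_log D v \<le> (LINT p:strip_box v r c|lborel. weight D p)"
    using ex[OF c(1,2)] by auto
  have "r < c \<and> a * r powr delta D v \<le> (LINT p:strip_box v r c|lborel. weight D p)"
    if "0 < r \<and> r < min c (exp (- 1))" for r
  proof -
    have "a * r powr delta D v * 1 \<le> a * r powr delta D v * \<bar>ln r\<bar> ^ delta_log D v"
      using that a abs_ln_power_ge_1[of r] by (intro mult_left_mono) auto
    with a(2)[of r] that show ?thesis by auto
  qed
  moreover have "min c (exp (- 1)) > 0" using c by simp
  ultimately show ?thesis using a(1) c by blast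
qed

text \<open>For \<open>r \<le> c\<close> the disk of radius \<open>r\<close> lies in the box and the
  weight is nonnegative, so the lower bound for the disk carries over.\<close>

lemma strip_mass_ge_eps:
  assumes "local_data D" "norm v = 1" "\<eta> > 0"
  shows "\<exists>a>0. \<exists>c>0. c < \<eta> \<and> (\<exists>r0>0. \<forall>r. 0 < r \<and> r < r0 \<longrightarrow>
           r < c \<and> a * r powr eps D \<le> (LINT p:strip_box v r c|lborel. weight D p))"
proof -
  obtain R where R: "R > 0" "set_integrable lborel (ball 0 R) (weight D)"
    using assms(1) by (auto simp: local_data_def)
  have "ball_exponents (weight D) (eps D) (eps_log D)"
    using assms unfolding local_data_def by blast
  then obtain c1 c3 where c1: "c1 > 0" "c3 > 0" and lb: "\<And>r. 0 < r \<Longrightarrow> r < c3 \<Longrightarrow>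
        c1 * r powr eps D * \<bar>ln r\<bar> ^ eps_log D \<le> (LINT p:ball 0 r|lborel. weight D p)"
    unfolding ball_exponents_def by metis
  \<comment> \<open>With \<open>2 * c \<le> R\<close> the box lies in a disk where the weight is
    integrable. This matters because the integral of a non-integrable function is 0 by convention,
    and monotonicity would fail.\<close>
  define c where "c = min \<eta> R / 2"
  have c: "0 < c" "2 * c \<le> R" "c < \<eta>" using R assms by (auto simp: c_def)
  have "r < c \<and> c1 * r powr eps D \<le> (LINT p:strip_box v r c|lborel. weight D p)"
    if "0 < r \<and> r < min c (min c3 (exp (- 1)))" for r
  proof -
    have "c1 * r powr eps D * 1 \<le> c1 * r powr eps D * \<bar>ln r\<bar> ^ eps_log D"
      using that c1 abs_ln_power_ge_1[of r] by (intro mult_left_mono) auto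
    also have "\<dots> \<le> (LINT p:ball 0 r|lborel. weight D p)" using lb that by auto
    also have "\<dots> \<le> (LINT p:strip_box v r c|lborel. weight D p)"
    proof -
      have sub: "ball 0 r \<subseteq> strip_box v r c" "strip_box v r c \<subseteq> ball 0 (2 * c)"
        using ball_subset_strip_box[OF assms(2)] strip_box_subset_ball[OF assms(2)] that by simp_all
      have R': "ball (0::plane) (2 * c) \<subseteq> ball 0 R" using c by (intro subset_ball) simp
      have "set_integrable lborel (strip_box v r c) (weight D)"
        using R(2) strip_box_measurable subset_trans[OF sub(2) R'] by (rule set_integrable_subset)
      moreover have "set_integrable lborel (ball 0 r) (weight D)"
        using R(2) _ subset_trans[OF subset_trans[OF sub] R'] by (rule set_integrable_subset) simp
      ultimately show ?thesis
        unfolding set_integrable_def set_lebesgue_integral_def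
        using sub(1) weight_nonneg[of D] by (intro integral_mono) (auto simp: indicator_def)
    qed
    finally show ?thesis using that by simp
  qed
  moreover have "min c (min c3 (exp (- 1))) > 0" using c c1 by simp
  ultimately show ?thesis using c1 c by blast
qed

text \<open>The smaller of \<open>eps M\<close> and \<open>delta M v\<close> serves as
  \<open>\<sigma>\<close>. Sharp type puts it below 1/2, and makes the exponent of the directional
  rate one of these two numbers, hence at least their minimum.\<close>

lemma sharp_type_strip_mass_ge:
  assumes "local_data M" "norm v = 1" "\<eta> > 0" "sharp_type M v"
  shows "\<exists>\<sigma> a c. 0 < \<sigma> \<and> \<sigma> < 1/2 \<and> \<sigma> \<le> fst (directional_rate M v) \<and> a > 0 \<and> c > 0 \<and> c < \<eta> \<and>
    (\<exists>r0>0. \<forall>r. 0 < r \<and> r < r0 \<longrightarrow>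
           r < c \<and> a * r powr \<sigma> \<le> (LINT p:strip_box v r c|lborel. weight M p))"
proof -
  have pos: "eps M > 0" "delta M v > 0"
    using assms(1,2) unfolding local_data_def ball_exponents_def strip_exponents_def by blast+
  consider "delta M v < 1/2" "delta M v \<le> fst (directional_rate M v)"
    | "eps M < 1/2" "eps M \<le> fst (directional_rate M v)"
    using assms(4) unfolding sharp_type_def directional_rate_def
    by (cases "delta M v \<le> eps M") (auto split: if_splits)
  then show ?thesis
  proof cases
    case 1
    then show ?thesis using strip_mass_ge_delta[OF assms(1-3)] pos by blast
  next
    case 2
    then show ?thesis using strip_mass_ge_eps[OF assms(1-3)] pos by blast
  qed
qed

text \<open>A small box translated to the base point lies in the infinite strip. On it the bump
  function is 1, so the multiplier is at least \<open>c\<close> times the weight; elsewhere in the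
  strip it is nonnegative.\<close>

lemma mult_strip_mass_ge:
  assumes M: "localized_multiplier M" and amp: "\<forall>p. base M + p \<in> mult_support M \<longrightarrow> amp M p > c"
    and "c > 0" "norm v = 1" "sharp_type M v"
  shows "\<exists>\<sigma> a. 0 < \<sigma> \<and> \<sigma> < 1/2 \<and> \<sigma> \<le> fst (directional_rate M v) \<and> a > 0 \<and>
    (\<exists>r0>0. \<forall>r. 0 < r \<and> r < r0 \<longrightarrow>
       a * r powr \<sigma> \<le> (LINT p:{p. \<bar>(p - base M) \<bullet> v\<bar> < r}|lborel. mult M p))"
proof -
  have loc: "local_data M" using M by (simp add: localized_multiplier_def)
  obtain R where R: "R > 0" "set_integrable lborel (ball 0 R) (weight M)"
    using loc by (auto simp: local_data_def)
  have "\<forall>\<^sub>F p in nhds (base M). bump M p = 1" using M by (simp add: localized_multiplier_def)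
  then obtain \<rho> where \<rho>: "\<rho> > 0" "\<And>p. dist p (base M) < \<rho> \<Longrightarrow> bump M p = 1"
    unfolding eventually_nhds_metric by blast
  \<comment> \<open>The bound \<open>min \<rho> R / 2\<close> is chosen because the box lies in the
    disk of radius \<open>2 * c'\<close>, which then fits both where the bump function is 1 and
    where the weight is integrable.\<close>
  obtain \<sigma> a c' r0 where \<sigma>: "0 < \<sigma>" "\<sigma> < 1/2" "\<sigma> \<le> fst (directional_rate M v)"
    and a: "a > 0" and c': "c' > 0" "c' < min \<rho> R / 2" and r0: "r0 > 0"
    and lb: "\<And>r. 0 < r \<Longrightarrow> r < r0 \<Longrightarrow> r < c' \<and> a * r powr \<sigma> \<le> (LINT p:strip_box v r c'|lborel. weight M p)"
    using sharp_type_strip_mass_ge[OF loc assms(4) _ assms(5), of "min \<rho> R / 2"] R \<rho> by auto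
  have mint: "integrable lborel (mult M)" using integrable_mult[OF M] .
  have nonneg: "mult M p \<ge> 0" for p
    using mult_nonneg[OF M amp \<open>c > 0\<close>] .
  have "(c * a) * r powr \<sigma> \<le> (LINT p:{p. \<bar>(p - base M) \<bullet> v\<bar> < r}|lborel. mult M p)"
    if r: "0 < r \<and> r < r0" for r
  proof -
    let ?B = "strip_box v r c'" and ?S = "{p. \<bar>(p - base M) \<bullet> v\<bar> < r}"
    have B: "?B \<subseteq> ball 0 (2 * c')" using strip_box_subset_ball[OF assms(4)] lb[of r] r by simp
    have "set_integrable lborel ?B (weight M)"
      using R(2) strip_box_measurable
      by (rule set_integrable_subset) (use B c' subset_ball[of "2 * c'" R "0::plane"] in auto)
    then have int: "integrable lborel (\<lambda>p. c * (indicator ?B p * weight M p))"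
      by (simp add: set_integrable_def)
    have "(c * a) * r powr \<sigma> \<le> c * (LINT p:?B|lborel. weight M p)"
      using lb[of r] r \<open>c > 0\<close> by (simp add: mult.assoc)
    also have "\<dots> = (LINT p|lborel. c * (indicator ?B p * weight M p))"
      by (simp add: set_lebesgue_integral_def)
    also have "\<dots> = (LINT p|lborel. c * (indicator ?B (p - base M) * weight M (p - base M)))"
      by (rule integrable_shift(2)[OF int, of "base M", symmetric])
    also have "(LINT p|lborel. c * (indicator ?B (p - base M) * weight M (p - base M)))
        \<le> (LINT p|lborel. indicator ?S p * mult M p)"
    proof (rule integral_mono)
      show "integrable lborel (\<lambda>p. c * (indicator ?B (p - base M) * weight M (p - base M)))"
        by (rule integrable_shift(1)[OF int, of "base M"])
      have "?S \<in> sets lborel"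
      proof -
        have "open ?S" by (intro open_Collect_less continuous_intros)
        then show ?thesis by simp
      qed
      then show "integrable lborel (\<lambda>p. indicator ?S p * mult M p)"
        using integrable_mult_indicator[OF _ mint, of ?S] by simp
      show "c * (indicator ?B (p - base M) * weight M (p - base M)) \<le> indicator ?S p * mult M p" for p
      proof (cases "p - base M \<in> ?B")
        case True
        then have "p \<in> ?S" by (simp add: strip_box_def)
        moreover have "bump M p = 1"
        proof (rule \<rho>)
          have "p - base M \<in> ball 0 (2 * c')" using True B by blast
          then show "dist p (base M) < \<rho>" using c' by (simp add: dist_norm norm_minus_commute)
        qed
        ultimately show ?thesis using mult_ge[OF M amp, of p] True by simp
      qed (use nonneg in auto)
    qed
    finally show ?thesis by (simp add: set_lebesgue_integral_def)
  qed
  then show ?thesis using \<sigma> a r0 \<open>c > 0\<close> mult_pos_pos[OF \<open>c > 0\<close> a] by blast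
qed

section \<open>Decay and sharpness for the sum\<close>

lemma scaleR_in_strip: "H > 0 \<Longrightarrow> k *\<^sub>R v \<in> strip v H"
  by (simp add: strip_def span_mul span_base)

theorem theorem1p6:
  fixes n :: nat and M :: "nat \<Rightarrow> multiplier" and c :: real
  assumes "\<forall>i\<in>{1..n}. localized_multiplier (M i)"
    and "\<forall>i\<in>{1..n}. eps (M i) < 1/2 \<or>
           (eps (M i) \<ge> 1/2 \<and> (\<exists>w. norm w = 1 \<and> delta (M i) w < 1/2))"
    and "\<forall>i\<in>{1..n}. estimates_hold (M i)"
    and "c > 0"
    and "\<forall>i\<in>{1..n}. \<forall>p. base (M i) + p \<in> mult_support (M i) \<longrightarrow> amp (M i) p > c"
  shows "(\<forall>t. kernel (mult_sum n M) t = (\<Sum>i\<in>{1..n}. kernel (mult (M i)) t)) \<and>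
    (\<forall>v H s. norm v = 1 \<longrightarrow> H > 0 \<longrightarrow>
       slowest ((\<lambda>i. directional_rate (M i) v) ` {1..n}) s \<longrightarrow>
         decay_estimate (kernel (mult_sum n M)) (strip v H) s \<and>
         ((\<exists>i0\<in>{1..n}. directional_rate (M i0) v = s \<and> sharp_type (M i0) v) \<longrightarrow>
            sharp_estimate (kernel (mult_sum n M)) (strip v H) s)) \<and>
    (\<forall>s. slowest {s'. \<exists>i\<in>{1..n}. overall_rate (M i) s'} s \<longrightarrow>
       decay_estimate (kernel (mult_sum n M)) UNIV s \<and>
       sharp_estimate (kernel (mult_sum n M)) UNIV s)"
proof -
  let ?K = "kernel (mult_sum n M)"
  have int: "integrable lborel (mult (M i))" if "i \<in> {1..n}" for i
    using integrable_mult assms(1) that by blast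
  have nonneg: "mult (M i) p \<ge> 0" if "i \<in> {1..n}" for i p
    using mult_nonneg[of "M i" c p] assms(1,4,5) that by blast
  have Kt: "?K t = (\<Sum>i\<in>{1..n}. kernel (mult (M i)) t)" for t
  proof -
    have "?K t = (LINT p|lborel. (\<Sum>i\<in>{1..n}. complex_of_real (mult (M i) p) * exp (\<i> * complex_of_real (p \<bullet> t))))"
      by (simp add: kernel_def mult_sum_def sum_distrib_right)
    also have "\<dots> = (\<Sum>i\<in>{1..n}. kernel (mult (M i)) t)"
      unfolding kernel_def by (intro Bochner_Integration.integral_sum integrable_times_exp int)
    finally show ?thesis .
  qed
  then have Keq: "?K = (\<lambda>t. \<Sum>i\<in>{1..n}. kernel (mult (M i)) t)" by blast
  have mint: "integrable lborel (mult_sum n M)"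
    unfolding mult_sum_def[abs_def] using int by (intro Bochner_Integration.integrable_sum)
  have mnonneg: "mult_sum n M p \<ge> 0" for p
    unfolding mult_sum_def using nonneg by (intro sum_nonneg)
  \<comment> \<open>Both sharpness claims reduce to this one: the directional claim directly, the
    overall claim by restriction to a strip along a direction that attains the rate.\<close>
  have sharp: "sharp_estimate ?K (strip v H) s"
    if v: "norm v = 1" and H: "H > 0" and i: "i \<in> {1..n}" and s: "directional_rate (M i) v = s" and st: "sharp_type (M i) v"
    for v H s i
    unfolding sharp_estimate_def
  proof (intro allI impI notI)
    fix \<sigma>' assume \<sigma>': "fst s < \<sigma>'" and dec: "decay_estimate ?K (strip v H) (\<sigma>', snd s)"
    obtain \<sigma>0 a r0 where \<sigma>0: "0 < \<sigma>0" "\<sigma>0 < 1/2" "\<sigma>0 \<le> fst s" and a: "a > 0" and r0: "r0 > 0"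
      and lb: "\<And>r. 0 < r \<Longrightarrow> r < r0 \<Longrightarrow>
         a * r powr \<sigma>0 \<le> (LINT p:{p. \<bar>(p - base (M i)) \<bullet> v\<bar> < r}|lborel. mult (M i) p)"
      using mult_strip_mass_ge[of "M i" c v] assms(1,4,5) i v st s by metis
    \<comment> \<open>The gap below \<open>\<sigma>'\<close> absorbs the power of the logarithm, the
      gap above \<open>\<sigma>0\<close> produces the contradiction, and \<open>\<sigma> < 1\<close>
      is required by \<open>strip_mass_le\<close>.\<close>
    obtain \<sigma> where \<sigma>: "\<sigma>0 < \<sigma>" "\<sigma> < \<sigma>'" "\<sigma> < 1"
      using dense[of \<sigma>0 "min \<sigma>' 1"] \<sigma>' \<sigma>0 by auto
    have "decay_estimate ?K (strip v H) (\<sigma>, 0)"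
      by (rule decay_estimate_slower[OF dec]) (simp add: slower_def \<sigma>)
    then obtain C where C: "\<And>t. t \<in> strip v H \<Longrightarrow> norm (?K t) \<le> C * (2 + norm t) powr (- \<sigma>)"
      unfolding decay_estimate_def by auto
    have C': "norm (?K (of_int k *\<^sub>R v)) \<le> C * (2 + \<bar>of_int k\<bar>) powr (- \<sigma>)" for k :: int
      using C[OF scaleR_in_strip[OF H]] v by simp
    have le: "a * (1 / real N) powr \<sigma>0 \<le> 8 * \<bar>C\<bar> / (1 - \<sigma>) * real N powr (- \<sigma>)"
      if N: "N > 0" "1 / real N < r0" for N
    proof -
      let ?S = "{p. \<bar>(p - base (M i)) \<bullet> v\<bar> < 1 / real N}"
      have "open ?S" by (intro open_Collect_less continuous_intros)
      then have S: "?S \<in> sets lborel" by simp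
      have "a * (1 / real N) powr \<sigma>0 \<le> (LINT p:?S|lborel. mult (M i) p)"
        using lb N by simp
      also have "\<dots> \<le> (LINT p:?S|lborel. mult_sum n M p)"
      proof (rule set_integral_mono)
        show "set_integrable lborel ?S (mult (M i))" "set_integrable lborel ?S (mult_sum n M)"
          unfolding set_integrable_def using integrable_mult_indicator[OF S] int[OF i] mint by blast+
        show "mult (M i) p \<le> mult_sum n M p" for p
          unfolding mult_sum_def using i nonneg by (intro member_le_sum) auto
      qed
      also have "\<dots> \<le> 8 * \<bar>C\<bar> / (1 - \<sigma>) * real N powr (- \<sigma>)"
        by (rule strip_mass_le[OF mint mnonneg _ _ C']) (use \<sigma> \<sigma>0 N in auto)
      finally show ?thesis .
    qed
    \<comment> \<open>Comparing the two bounds for the mass at \<open>r = 1 / N\<close> leaves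
      \<open>1 \<le> B * N powr (\<sigma>0 - \<sigma>)\<close>, whose right side tends to 0.\<close>
    define B where "B = 8 * \<bar>C\<bar> / (1 - \<sigma>) / a"
    have bound: "1 \<le> B * real N powr (\<sigma>0 - \<sigma>)" if N: "N > 0" "1 / real N < r0" for N
    proof -
      have "a * real N powr (- \<sigma>0) \<le> a * (B * real N powr (- \<sigma>))"
        using le[OF N] a N by (simp add: B_def powr_divide powr_minus_divide)
      then have "real N powr (- \<sigma>0) \<le> B * real N powr (- \<sigma>)"
        using a by simp
      then have "real N powr (- \<sigma>0) * real N powr \<sigma>0 \<le> (B * real N powr (- \<sigma>)) * real N powr \<sigma>0"
        by (intro mult_right_mono) auto
      then show ?thesis
        using N by (simp add: powr_add[symmetric] mult.assoc)
    qed
    have "(\<lambda>N. B * real N powr (\<sigma>0 - \<sigma>)) \<longlonglongrightarrow> B * 0"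
      using \<sigma> by (intro tendsto_mult tendsto_const tendsto_neg_powr filterlim_real_sequentially) simp
    then have "eventually (\<lambda>N. B * real N powr (\<sigma>0 - \<sigma>) < 1) sequentially"
      by (rule order_tendstoD(2)) simp
    moreover have "eventually (\<lambda>N. 1 / real N < r0) sequentially"
      using order_tendstoD(2)[OF lim_1_over_n r0] .
    ultimately have "eventually (\<lambda>N::nat. False) sequentially"
      using eventually_gt_at_top[of 0]
    proof eventually_elim
      case (elim N)
      then show ?case using bound[of N] by linarith
    qed
    then show False by simp
  qed
  \<comment> \<open>The alternative \<open>t = s\<close> is listed separately because
    \<open>slower\<close> is a strict order.\<close>
  have upper: "decay_estimate ?K S s"
    if "\<And>i. i \<in> {1..n} \<Longrightarrow> \<exists>t. decay_estimate (kernel (mult (M i))) S t \<and> (t = s \<or> slower s t)" for S s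
    unfolding Keq using that by (intro decay_estimate_sum) (metis decay_estimate_slower)
  show ?thesis
  proof (intro conjI allI impI)
    show "?K t = (\<Sum>i\<in>{1..n}. kernel (mult (M i)) t)" for t by (rule Kt)
  next
    fix v H s assume v: "norm v = 1" and H: "(0::real) < H"
      and s: "slowest ((\<lambda>i. directional_rate (M i) v) ` {1..n}) s"
    show "decay_estimate ?K (strip v H) s"
    proof (rule upper)
      fix i assume i: "i \<in> {1..n}"
      then have "decay_estimate (kernel (mult (M i))) (strip v H) (directional_rate (M i) v)"
        using assms(3) v H unfolding estimates_hold_def by blast
      then show "\<exists>t. decay_estimate (kernel (mult (M i))) (strip v H) t \<and> (t = s \<or> slower s t)"
        using s i unfolding slowest_def by blast
    qed
    assume "\<exists>i0\<in>{1..n}. directional_rate (M i0) v = s \<and> sharp_type (M i0) v"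
    then show "sharp_estimate ?K (strip v H) s" using sharp v H by blast
  next
    fix s assume s: "slowest {s'. \<exists>i\<in>{1..n}. overall_rate (M i) s'} s"
    show "decay_estimate ?K UNIV s"
    proof (rule upper)
      fix i assume i: "i \<in> {1..n}"
      then obtain t where "overall_rate (M i) t" "decay_estimate (kernel (mult (M i))) UNIV t"
        using assms(3) unfolding estimates_hold_def by blast
      then show "\<exists>t. decay_estimate (kernel (mult (M i))) UNIV t \<and> (t = s \<or> slower s t)"
        using s i unfolding slowest_def by blast
    qed
    obtain i where i: "i \<in> {1..n}" and sl: "slowest {directional_rate (M i) v | v. norm v = 1} s"
      using s unfolding slowest_def overall_rate_def by blast
    then obtain v where v: "norm v = 1" "directional_rate (M i) v = s"
      unfolding slowest_def by blast
    \<comment> \<open>If \<open>eps (M i) \<ge> 1/2\<close>, a direction \<open>w\<close> with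
      \<open>delta (M i) w < 1/2\<close> has a rate with exponent below 1/2. The slowest rate then
      has exponent below 1/2 as well, so it is not \<open>(1/2, 2)\<close>, and the direction
      attaining it has \<open>delta\<close> below 1/2.\<close>
    have "sharp_type (M i) v"
    proof (cases "eps (M i) < 1/2")
      case False
      then obtain w where w: "norm w = 1" "delta (M i) w < 1/2" using assms(2) i by blast
      have "directional_rate (M i) w = s \<or> slower s (directional_rate (M i) w)"
        using sl w unfolding slowest_def by blast
      then have "fst s < 1/2"
        using w False by (auto simp: slower_def directional_rate_def)
      then show ?thesis using v(2) False by (auto simp: sharp_type_def directional_rate_def split: if_splits)
    qed (simp add: sharp_type_def)
    \<comment> \<open>The width 1 is arbitrary: an improved estimate on the whole plane would
      restrict to every strip.\<close>
    then have "sharp_estimate ?K (strip v 1) s" using sharp[OF v(1) _ i v(2)] by simp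
    then show "sharp_estimate ?K UNIV s"
      unfolding sharp_estimate_def using decay_estimate_subset[of ?K UNIV] by blast
  qed
qed

end
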